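(* Let $\Sigma$ be a finite alphabet and let $L\subseteq\Sigma^\omega$ be an analytic but non-Borel set accepted by a real-time 1-counter Büchi automaton. Then there is an $\omega$-language $L'$ accepted by a real-time 4-blind-counter Büchi automaton such that $L\equiv_W L'$.
   Context: A real-time $k$-counter Büchi automaton is a tuple $(K,\Sigma,\Delta,q_0,F)$ with finite states $K$, initial state $q_0$, accepting states $F$ and $\Delta\subseteq K\times\Sigma\times\{0,1\}^k\times K\times\{-1,0,1\}^k$ (no transition has $i_m=0$ and $j_m=-1$). From configuration $(q,c)\in K\times\mathbb{N}^k$, reading $a$, it may go to $(q',c+j)$ if $(q,a,i,q',j)\in\Delta$ with $i_m=0$ iff $c_m=0$. Runs on $\omega$-words start in $(q_0,0,\dots,0)$, read one letter per step, and are accepting if a state of $F$ occurs infinitely often; the accepted $\omega$-language is the set of words with an accepting run. Counters are blind if whenever a transition with $i_m=0$ is in $\Delta$, the same transition with $i_m=1$ is also in $\Delta$. $\Sigma^\omega$ has the Cantor topology; $L\le_W L'$ iff $L=f^{-1}(L')$ for some continuous $f$, and $\equiv_W$ is the induced equivalence. *)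

theory Defs
  imports "HOL-Analysis.Analysis" "HOL-Library.Infinite_Set"
begin

text \<open>Transitions (q, a, i, q', j): i is the zero-test vector (True = 1 = nonzero),
  j is the counter update vector with entries in {-1,0,1}; both of length k.\<close>
type_synonym ('q,'a) ctrans = "'q \<times> 'a \<times> bool list \<times> 'q \<times> int list"

definition counter_automaton ::
  "nat \<Rightarrow> 'q set \<Rightarrow> 'a set \<Rightarrow> ('q,'a) ctrans set \<Rightarrow> 'q \<Rightarrow> 'q set \<Rightarrow> bool" where
  "counter_automaton k K Sig Delta q0 F \<longleftrightarrow>
     finite K \<and> finite Sig \<and> q0 \<in> K \<and> F \<subseteq> K \<and>
     (\<forall>(q,a,i,q',j) \<in> Delta. q \<in> K \<and> a \<in> Sig \<and> q' \<in> K \<and>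
        length i = k \<and> length j = k \<and> set j \<subseteq> {-1,0,1} \<and>
        (\<forall>m<k. \<not> i!m \<longrightarrow> j!m \<noteq> -1))"

definition blind_counters :: "nat \<Rightarrow> ('q,'a) ctrans set \<Rightarrow> bool" where
  "blind_counters k Delta \<longleftrightarrow>
     (\<forall>(q,a,i,q',j) \<in> Delta. \<forall>m<k. \<not> i!m \<longrightarrow> (q,a,i[m := True],q',j) \<in> Delta)"

definition cstep :: "('q,'a) ctrans set \<Rightarrow> 'q \<times> nat list \<Rightarrow> 'a \<Rightarrow> 'q \<times> nat list \<Rightarrow> bool" where
  "cstep Delta C a C' \<longleftrightarrow>
     (\<exists>i j. (fst C, a, i, fst C', j) \<in> Delta \<and>
        length i = length (snd C) \<and> length j = length (snd C) \<and>
        length (snd C') = length (snd C) \<and>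
        (\<forall>m<length (snd C). (i!m \<longleftrightarrow> snd C ! m \<noteq> 0) \<and>
            int (snd C' ! m) = int (snd C ! m) + j!m))"

definition is_run :: "nat \<Rightarrow> ('q,'a) ctrans set \<Rightarrow> 'q \<Rightarrow> (nat \<Rightarrow> 'a) \<Rightarrow> (nat \<Rightarrow> 'q \<times> nat list) \<Rightarrow> bool" where
  "is_run k Delta q0 x r \<longleftrightarrow> r 0 = (q0, replicate k 0) \<and> (\<forall>n. cstep Delta (r n) (x n) (r (Suc n)))"

definition omega_lang :: "nat \<Rightarrow> 'a set \<Rightarrow> ('q,'a) ctrans set \<Rightarrow> 'q \<Rightarrow> 'q set \<Rightarrow> (nat \<Rightarrow> 'a) set" where
  "omega_lang k Sig Delta q0 F =
     {x. (\<forall>n. x n \<in> Sig) \<and> (\<exists>r. is_run k Delta q0 x r \<and> (\<exists>\<^sub>\<infinity>n. fst (r n) \<in> F))}"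

definition cantor_top :: "'a set \<Rightarrow> (nat \<Rightarrow> 'a) topology" where
  "cantor_top Sig = product_topology (\<lambda>_. discrete_topology Sig) UNIV"

definition baire_top :: "(nat \<Rightarrow> nat) topology" where
  "baire_top = product_topology (\<lambda>_. discrete_topology UNIV) UNIV"

definition borel_in :: "'a topology \<Rightarrow> 'a set \<Rightarrow> bool" where
  "borel_in X A \<longleftrightarrow> A \<in> sigma_sets (topspace X) {U. openin X U}"

definition analytic_in :: "'a topology \<Rightarrow> 'a set \<Rightarrow> bool" where
  "analytic_in X A \<longleftrightarrow> A = {} \<or> (\<exists>f. continuous_map baire_top X f \<and> f ` topspace baire_top = A)"

definition wadge_le :: "'a topology \<Rightarrow> 'a set \<Rightarrow> 'b topology \<Rightarrow> 'b set \<Rightarrow> bool" where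
  "wadge_le X A Y B \<longleftrightarrow> (\<exists>f. continuous_map X Y f \<and> A = {x \<in> topspace X. f x \<in> B})"

definition wadge_equiv :: "'a topology \<Rightarrow> 'a set \<Rightarrow> 'b topology \<Rightarrow> 'b set \<Rightarrow> bool" where
  "wadge_equiv X A Y B \<longleftrightarrow> wadge_le X A Y B \<and> wadge_le Y B X A"

end

(* The four blind counters cannot verify that a word is a correct code of a word over Sig: they detect
   at once that a block of zeros is too long, whereas for a block which is too short they can only
   guess it and then accept. So a player who enumerates a word may at any time leave the set of
   codes, with an outcome that is then decided by a finite prefix, and the simulation can be
   equivalent to L only if these exits do not increase its Wadge degree.

   Call a word s resolvable if membership in L of the extensions of s is the limit of a function of
   their finite prefixes. If all extensions of s in L (or all those not in L) have a resolvable
   prefix, then s is resolvable: take the function of the first resolvable prefix, and before it a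
   constant. Hence a nonresolvable word has extensions inside and outside of L all of whose prefixes
   are nonresolvable. In the Wadge game, the player on L copies as long as the word is nonresolvable.
   When the opponent makes it resolvable, by an exit or not, his membership becomes a limit of
   guesses, and the player stands on a nonresolvable word, from which he can change his mind at will.
   If L is not Borel, then the empty word is nonresolvable. *)
theory Submission
  imports Defs
begin

section \<open>Infinite words and their prefixes\<close>

definition words :: "'a set \<Rightarrow> (nat \<Rightarrow> 'a) set" where
  "words S = {x. \<forall>n. x n \<in> S}"

definition pre :: "(nat \<Rightarrow> 'a) \<Rightarrow> nat \<Rightarrow> 'a list" where
  "pre x n = map x [0..<n]"

lemma wordsI: "(\<And>n. x n \<in> S) \<Longrightarrow> x \<in> words S"
  and wordsD: "x \<in> words S \<Longrightarrow> x n \<in> S"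
  by (auto simp: words_def)

lemma length_pre [simp]: "length (pre x n) = n"
  by (simp add: pre_def)

lemma nth_pre [simp]: "i < n \<Longrightarrow> pre x n ! i = x i"
  by (simp add: pre_def)

lemma pre_0 [simp]: "pre x 0 = []"
  by (simp add: pre_def)

lemma pre_eq_iff: "pre x n = pre y n \<longleftrightarrow> (\<forall>i<n. x i = y i)"
  by (auto simp: list_eq_iff_nth_eq)

lemma take_pre: "take k (pre x n) = pre x (min k n)"
  by (auto simp: list_eq_iff_nth_eq)

lemma pre_eq_mono: "pre x n = pre y n \<Longrightarrow> m \<le> n \<Longrightarrow> pre x m = pre y m"
  by (auto simp: pre_eq_iff)

lemma topspace_cantor [simp]: "topspace (cantor_top S) = words S"
  by (auto simp: cantor_top_def words_def)

lemma openin_cylinder: "openin (cantor_top S) {x \<in> words S. pre x n = w}"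
proof (cases "length w = n")
  case True
  let ?U = "\<lambda>i. if i < n then S \<inter> {w ! i} else S"
  have "openin (cantor_top S) (PiE UNIV ?U)"
    unfolding cantor_top_def openin_PiE_gen
    by (auto intro!: disjI2 finite_subset[of _ "{..<n}"])
  moreover have "PiE UNIV ?U = {x \<in> words S. pre x n = w}"
  proof (intro equalityI subsetI)
    fix x assume "x \<in> PiE UNIV ?U"
    then have *: "x i \<in> ?U i" for i by blast
    have "x i \<in> S" "i < n \<Longrightarrow> x i = w ! i" for i using *[of i] by (auto split: if_splits)
    then show "x \<in> {x \<in> words S. pre x n = w}"
      using True by (auto simp: words_def list_eq_iff_nth_eq)
  next
    fix x assume "x \<in> {x \<in> words S. pre x n = w}"
    then have "x \<in> words S" "w = pre x n" by auto
    then show "x \<in> PiE UNIV ?U" by (auto simp: words_def)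
  qed
  ultimately show ?thesis by simp
next
  case False
  then have empty: "{x \<in> words S. pre x n = w} = {}" by auto
  show ?thesis unfolding empty by simp
qed

lemma openin_cantorI:
  assumes "U \<subseteq> words S"
    and "\<And>x. x \<in> U \<Longrightarrow> \<exists>n. \<forall>y\<in>words S. pre y n = pre x n \<longrightarrow> y \<in> U"
  shows "openin (cantor_top S) U"
proof (subst openin_subopen, intro ballI)
  fix x assume x: "x \<in> U"
  then obtain n where n: "\<forall>y\<in>words S. pre y n = pre x n \<longrightarrow> y \<in> U" using assms(2) by blast
  show "\<exists>T. openin (cantor_top S) T \<and> x \<in> T \<and> T \<subseteq> U"
    using n x assms(1) openin_cylinder[of S n "pre x n"] by blast
qed

lemma continuous_map_cantorI:
  assumes "\<And>x. x \<in> words S \<Longrightarrow> f x \<in> words T"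
    and "\<And>x i. x \<in> words S \<Longrightarrow> \<exists>n. \<forall>y\<in>words S. pre y n = pre x n \<longrightarrow> f y i = f x i"
  shows "continuous_map (cantor_top S) (cantor_top T) f"
proof -
  have "continuous_map (cantor_top S) (discrete_topology T) (\<lambda>x. f x i)" for i
    unfolding continuous_map_def
  proof (intro conjI allI impI)
    show "(\<lambda>x. f x i) \<in> topspace (cantor_top S) \<rightarrow> topspace (discrete_topology T)"
      using assms(1) by (auto dest: wordsD)
    fix V assume "openin (discrete_topology T) V"
    show "openin (cantor_top S) {x \<in> topspace (cantor_top S). f x i \<in> V}"
    proof (rule openin_cantorI)
      fix x assume x: "x \<in> {x \<in> topspace (cantor_top S). f x i \<in> V}"
      then obtain n where n: "\<And>y. y \<in> words S \<Longrightarrow> pre y n = pre x n \<Longrightarrow> f y i = f x i"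
        using assms(2)[of x i] by auto
      show "\<exists>n. \<forall>y\<in>words S. pre y n = pre x n \<longrightarrow> y \<in> {x \<in> topspace (cantor_top S). f x i \<in> V}"
      proof (intro exI ballI impI)
        fix y assume "y \<in> words S" "pre y n = pre x n"
        from n[OF this] this(1) x show "y \<in> {x \<in> topspace (cantor_top S). f x i \<in> V}" by auto
      qed
    qed auto
  qed
  then show ?thesis
    by (subst (2) cantor_top_def) (auto simp: continuous_map_componentwise_UNIV)
qed

section \<open>Limit-decidable sets\<close>

text \<open>By the limit lemma, this says that \<open>L\<close> is (boldface) Delta^0_2 within the
  cylinder of \<open>s\<close>.\<close>

definition resolvable :: "'a set \<Rightarrow> (nat \<Rightarrow> 'a) set \<Rightarrow> 'a list \<Rightarrow> bool" where
  "resolvable S L s \<longleftrightarrow> (\<exists>v :: 'a list \<Rightarrow> bool. \<forall>x\<in>words S. pre x (length s) = s \<longrightarrow>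
      (\<forall>\<^sub>F n in sequentially. v (pre x n) = (x \<in> L)))"

lemma resolvable_mono:
  "resolvable S L (pre x m) \<Longrightarrow> m \<le> n \<Longrightarrow> resolvable S L (pre x n)"
  unfolding resolvable_def length_pre by (meson pre_eq_mono)

text \<open>\<open>L\<close> is the set of words on which the guess \<open>v\<close> is eventually
  true: a countable union of countable intersections of clopen sets.\<close>

lemma resolvable_Nil_imp_borel:
  assumes "resolvable S L []" and "L \<subseteq> words S"
  shows "borel_in (cantor_top S) L"
proof -
  obtain v where v: "\<And>x. x \<in> words S \<Longrightarrow> \<forall>\<^sub>F n in sequentially. v (pre x n) = (x \<in> L)"
    using assms(1) by (auto simp: resolvable_def)
  let ?A = "\<lambda>n. {x \<in> words S. v (pre x n)}"
  let ?B = "sigma_sets (topspace (cantor_top S)) {U. openin (cantor_top S) U}"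
  interpret sigma_algebra "topspace (cantor_top S)" ?B
    by (rule sigma_algebra_sigma_sets) (use openin_subset in blast)
  have "?A n \<in> ?B" for n
    by (rule sigma_sets.Basic, simp, rule openin_cantorI) (auto intro!: exI[of _ n])
  then have "(\<Union>N. \<Inter>n\<in>{N..}. ?A n) \<in> ?B"
    by (intro countable_nat_UN image_subsetI countable_INT) auto
  moreover have "L = (\<Union>N. \<Inter>n\<in>{N..}. ?A n)"
  proof (intro equalityI subsetI)
    fix x assume "x \<in> L"
    with v[of x] assms(2) show "x \<in> (\<Union>N. \<Inter>n\<in>{N..}. ?A n)"
      by (auto simp: eventually_sequentially)
  next
    fix x assume "x \<in> (\<Union>N. \<Inter>n\<in>{N..}. ?A n)"
    then obtain N where N: "\<forall>n\<ge>N. x \<in> ?A n" by auto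
    then have x: "x \<in> words S" by auto
    obtain M where "\<forall>n\<ge>M. v (pre x n) = (x \<in> L)"
      using v[OF x] by (auto simp: eventually_sequentially)
    with N show "x \<in> L" by (metis (mono_tags, lifting) linear mem_Collect_eq)
  qed
  ultimately show ?thesis by (simp add: borel_in_def)
qed

lemma nonresolvable_branch:
  assumes "\<not> resolvable S L s"
  shows "\<exists>x\<in>words S. pre x (length s) = s \<and> (x \<in> L \<longleftrightarrow> b) \<and> (\<forall>n. \<not> resolvable S L (pre x n))"
proof (rule ccontr)
  assume no: "\<not> ?thesis"
  \<comment> \<open>One guess function is fixed for each resolvable \<open>t\<close>, so that the
    guesses can be glued together.\<close>
  define V where "V t = (SOME v. \<forall>x\<in>words S. pre x (length t) = t \<longrightarrow>
      (\<forall>\<^sub>F n in sequentially. v (pre x n) = (x \<in> L)))" for t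
  have V: "\<forall>\<^sub>F n in sequentially. V t (pre x n) = (x \<in> L)"
    if "resolvable S L t" "x \<in> words S" "pre x (length t) = t" for t x
    using someI_ex[OF that(1)[unfolded resolvable_def]] that(2,3) unfolding V_def by blast
  \<comment> \<open>Once a word has a resolvable prefix, the least one stays the same, so from then
    on the guesses of a single \<open>V t\<close> are used. The default \<open>\<not> b\<close> is
    right for words without resolvable prefix, since by \<open>no\<close> none of them has
    membership \<open>b\<close>.\<close>
  define v where "v u = (if \<exists>k. resolvable S L (take k u)
      then V (take (LEAST k. resolvable S L (take k u)) u) u else \<not> b)" for u
  have "\<forall>\<^sub>F n in sequentially. v (pre x n) = (x \<in> L)"
    if x: "x \<in> words S" "pre x (length s) = s" for x
  proof (cases "\<exists>n. resolvable S L (pre x n)")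
    case True
    define N where "N = (LEAST n. resolvable S L (pre x n))"
    have N: "resolvable S L (pre x N)" unfolding N_def using True by (rule LeastI_ex)
    have v: "v (pre x n) = V (pre x N) (pre x n)" if "n \<ge> N" for n
    proof -
      have "(LEAST k. resolvable S L (take k (pre x n))) = N"
      proof (rule Least_equality)
        show "resolvable S L (take N (pre x n))" using N that by (simp add: take_pre)
        fix k assume "resolvable S L (take k (pre x n))"
        then have "N \<le> min k n" unfolding N_def take_pre by (rule Least_le)
        then show "N \<le> k" by simp
      qed
      moreover have "\<exists>k. resolvable S L (take k (pre x n))"
        using N that by (intro exI[of _ N]) (simp add: take_pre)
      ultimately show ?thesis unfolding v_def using that by (simp add: take_pre)
    qed
    have "\<forall>\<^sub>F n in sequentially. V (pre x N) (pre x n) = (x \<in> L)"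
      using V[OF N x(1)] by simp
    with eventually_ge_at_top[of N] show ?thesis by eventually_elim (simp add: v)
  next
    case False
    then have "v (pre x n) = (\<not> b)" for n by (auto simp: v_def take_pre)
    moreover have "(x \<in> L) = (\<not> b)" using no False x by auto
    ultimately show ?thesis by simp
  qed
  then have "resolvable S L s" unfolding resolvable_def by blast
  with assms show False by simp
qed

section \<open>The player's strategy in the Wadge game\<close>

definition branch :: "'a set \<Rightarrow> (nat \<Rightarrow> 'a) set \<Rightarrow> bool \<Rightarrow> 'a list \<Rightarrow> nat \<Rightarrow> 'a" where
  "branch S L b s = (SOME x. x \<in> words S \<and> pre x (length s) = s \<and> (x \<in> L \<longleftrightarrow> b) \<and>
      (\<forall>n. \<not> resolvable S L (pre x n)))"

lemma branch:
  assumes "\<not> resolvable S L s"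
  shows "branch S L b s \<in> words S" "pre (branch S L b s) (length s) = s"
    "branch S L b s \<in> L \<longleftrightarrow> b" "\<not> resolvable S L (pre (branch S L b s) n)"
proof -
  have "\<exists>x. x \<in> words S \<and> pre x (length s) = s \<and> (x \<in> L \<longleftrightarrow> b) \<and>
      (\<forall>n. \<not> resolvable S L (pre x n))"
    using nonresolvable_branch[OF assms] by blast
  from someI_ex[OF this] show "branch S L b s \<in> words S" "pre (branch S L b s) (length s) = s"
    "branch S L b s \<in> L \<longleftrightarrow> b" "\<not> resolvable S L (pre (branch S L b s) n)"
    by (auto simp: branch_def)
qed

text \<open>Stage \<open>n\<close> is the word the player plans to enumerate after \<open>n\<close>
  guesses. A change of plan at stage \<open>Suc n\<close> keeps the first
  \<open>length s + n\<close> letters, so letter \<open>i\<close> is final from stage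
  \<open>Suc i\<close> on, and the diagonal is the word actually played.\<close>

primrec chase :: "'a set \<Rightarrow> (nat \<Rightarrow> 'a) set \<Rightarrow> ('b list \<Rightarrow> bool) \<Rightarrow> (nat \<Rightarrow> 'b) \<Rightarrow> 'a list \<Rightarrow>
    nat \<Rightarrow> nat \<Rightarrow> 'a" where
  "chase S L v y s 0 = branch S L True s"
| "chase S L v y s (Suc n) = (let x = chase S L v y s n in
     if (x \<in> L) = v (pre y n) then x else branch S L (v (pre y n)) (pre x (length s + n)))"

context
  fixes S :: "'a set" and L :: "(nat \<Rightarrow> 'a) set" and v :: "'b list \<Rightarrow> bool" and s :: "'a list"
  assumes s: "\<not> resolvable S L s"
begin

text \<open>Every plan has only nonresolvable prefixes; this is what allows a branch of either
  membership to be chosen at each later stage.\<close>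

lemma chase_nonresolvable:
  "chase S L v y s n \<in> words S" "\<not> resolvable S L (pre (chase S L v y s n) m)"
proof (induction n arbitrary: m)
  case 0
  {case 1 show ?case by (simp add: branch[OF s]) next
   case 2 show ?case by (simp add: branch[OF s])}
next
  case (Suc n)
  {case 1 show ?case using Suc branch(1)[OF Suc(2)] by (simp add: Let_def) next
   case 2 show ?case using Suc branch(4)[OF Suc(2)] by (simp add: Let_def)}
qed

lemma chase_Suc:
  "pre (chase S L v y s (Suc n)) (length s + n) = pre (chase S L v y s n) (length s + n)"
  "chase S L v y s (Suc n) \<in> L \<longleftrightarrow> v (pre y n)"
  using branch(2,3)[OF chase_nonresolvable(2)[of y n "length s + n"]] by (auto simp: Let_def)

lemma chase_mono:
  "n \<le> m \<Longrightarrow> pre (chase S L v y s m) (length s + n) = pre (chase S L v y s n) (length s + n)"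
proof (induction m rule: dec_induct)
  case (step m)
  have "pre (chase S L v y s (Suc m)) (length s + n) = pre (chase S L v y s m) (length s + n)"
    by (rule pre_eq_mono[OF chase_Suc(1)]) (use step in simp)
  with step show ?case by simp
qed simp

lemma chase_prefix: "pre (chase S L v y s n) (length s) = s"
  using chase_mono[of 0 n y] branch(2)[OF s, of True] by simp

lemma chase_cong: "pre y n = pre y' n \<Longrightarrow> chase S L v y s n = chase S L v y' s n"
proof (induction n)
  case (Suc n)
  then have "pre y n = pre y' n" using pre_eq_mono le_SucI by blast
  with Suc show ?case by (simp only: chase.simps)
qed simp

lemma chase_limit:
  assumes "\<forall>\<^sub>F n in sequentially. v (pre y n) = b"
  shows "(\<lambda>i. chase S L v y s (Suc i) i) \<in> L \<longleftrightarrow> b"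
proof -
  obtain N where N: "\<And>n. n \<ge> N \<Longrightarrow> v (pre y n) = b"
    using assms by (auto simp: eventually_sequentially)
  \<comment> \<open>The plan at stage \<open>Suc N\<close> answers the guess made at
    \<open>N\<close>, which is already \<open>b\<close>, so no later guess changes it.\<close>
  have const: "chase S L v y s n = chase S L v y s (Suc N)" if "n \<ge> Suc N" for n
    using that
  proof (induction n rule: dec_induct)
    case (step m)
    have "(chase S L v y s m \<in> L) = b"
      using chase_Suc(2)[of y N] N[of N] step by simp
    then show ?case using step N[of m] by (simp add: Let_def)
  qed simp
  have "chase S L v y s (Suc i) i = chase S L v y s (Suc N) i" for i
  proof -
    have "pre (chase S L v y s (max (Suc i) (Suc N))) (length s + Suc i)
        = pre (chase S L v y s (Suc i)) (length s + Suc i)"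
      by (rule chase_mono) simp
    then show ?thesis using const[of "max (Suc i) (Suc N)"] by (simp add: pre_eq_iff)
  qed
  then have "(\<lambda>i. chase S L v y s (Suc i) i) = chase S L v y s (Suc N)" by blast
  then show ?thesis using chase_Suc(2)[of y N] N[of N] by simp
qed

end

text \<open>As long as the opponent's prefix is not resolvable, the player copies its decoding; afterwards
  he follows a branch whose membership in \<open>L\<close> is the current value of the opponent's limit
  computation, and changes the branch whenever that value changes.\<close>
lemma wadge_le_by_decoding:
  fixes L :: "(nat \<Rightarrow> 'a) set" and M :: "(nat \<Rightarrow> 'b) set"
    and d :: "(nat \<Rightarrow> 'b) \<Rightarrow> nat \<Rightarrow> 'a" and g :: "nat \<Rightarrow> nat"
  assumes L: "\<not> resolvable S L []" and M: "M \<subseteq> words T"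
    and d: "\<And>y y' n. pre y n = pre y' n \<Longrightarrow> pre (d y) (g n) = pre (d y') (g n)"
    and g: "mono g" "\<And>i. \<exists>n. i < g n"
    and res: "\<And>y n. y \<in> words T \<Longrightarrow> \<not> resolvable T M (pre y n) \<Longrightarrow>
       \<not> resolvable S L (pre (d y) (g n))"
    and nonres: "\<And>y. y \<in> words T \<Longrightarrow> \<forall>n. \<not> resolvable T M (pre y n) \<Longrightarrow> y \<in> M \<longleftrightarrow> d y \<in> L"
  shows "wadge_le (cantor_top T) M (cantor_top S) L"
proof -
  define V where "V t = (SOME v. \<forall>x\<in>words T. pre x (length t) = t \<longrightarrow>
      (\<forall>\<^sub>F n in sequentially. v (pre x n) = (x \<in> M)))" for t
  have V: "\<forall>\<^sub>F n in sequentially. V t (pre x n) = (x \<in> M)"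
    if "resolvable T M t" "x \<in> words T" "pre x (length t) = t" for t x
    using someI_ex[OF that(1)[unfolded resolvable_def]] that(2,3) unfolding V_def by blast
  \<comment> \<open>\<open>N y\<close> is the moment at which the opponent's prefix becomes
    resolvable, and \<open>s y\<close> is what the player has copied one step earlier. By
    \<open>res\<close> (or by \<open>L\<close> if \<open>N y = 0\<close>) that word is
    nonresolvable, so a chase can start from it.\<close>
  define N where "N y = (LEAST n. resolvable T M (pre y n))" for y
  define s where "s y = (if N y = 0 then [] else pre (d y) (g (N y - 1)))" for y
  define f where "f y = (if \<forall>n. \<not> resolvable T M (pre y n) then d y
      else (\<lambda>i. chase S L (V (pre y (N y))) y (s y) (Suc i) i))" for y
  have resN: "resolvable T M (pre y (N y))" if "resolvable T M (pre y n)" for y n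
    unfolding N_def by (rule LeastI[of "\<lambda>n. resolvable T M (pre y n)", OF that])
  have nresN: "\<not> resolvable T M (pre y n)" if "n < N y" for y n
    using that not_less_Least unfolding N_def by blast
  have s: "\<not> resolvable S L (s y)" if "y \<in> words T" for y
    using L res[OF that nresN[of "N y - 1" y]] by (auto simp: s_def)
  have in_words: "f y \<in> words S" if y: "y \<in> words T" for y
  proof (cases "\<forall>n. \<not> resolvable T M (pre y n)")
    case True
    have "d y i \<in> S" for i
    proof -
      obtain n where n: "i < g n" using g(2) by blast
      \<comment> \<open>A nonresolvable prefix extends to a word of \<open>words S\<close>, so its
        letters lie in \<open>S\<close>.\<close>
      have "\<not> resolvable S L (pre (d y) (g n))" using True res y by blast
      from branch(1,2)[OF this, of True] n show ?thesis
        by (metis length_pre pre_eq_iff wordsD)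
    qed
    with True show ?thesis by (simp add: f_def words_def)
  next
    case False
    then show ?thesis using chase_nonresolvable(1)[OF s[OF y]]
      by (auto simp: f_def words_def simp del: chase.simps)
  qed
  have red: "y \<in> M \<longleftrightarrow> f y \<in> L" if y: "y \<in> words T" for y
  proof (cases "\<forall>n. \<not> resolvable T M (pre y n)")
    case True
    then show ?thesis using nonres[OF y] by (simp add: f_def)
  next
    case False
    then have "resolvable T M (pre y (N y))" using resN by blast
    have "f y = (\<lambda>i. chase S L (V (pre y (N y))) y (s y) (Suc i) i)"
      unfolding f_def using False by (rule if_not_P)
    then show ?thesis using chase_limit[OF s[OF y] V[OF \<open>resolvable T M (pre y (N y))\<close> y]]
      by (simp del: chase.simps)
  qed
  have "\<exists>n. \<forall>y'\<in>words T. pre y' n = pre y n \<longrightarrow> f y' i = f y i" if y: "y \<in> words T" for y i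
  proof (cases "\<forall>n. \<not> resolvable T M (pre y n)")
    case True
    obtain n where n: "i < g n" using g(2) by blast
    \<comment> \<open>If \<open>y'\<close> becomes resolvable at all, it does so after
      \<open>n\<close>. Letter \<open>i\<close> then belongs to the part \<open>s y'\<close> that
      was still copied, and \<open>chase_prefix\<close> preserves it.\<close>
    have "f y' i = f y i" if y': "y' \<in> words T" and eq: "pre y' n = pre y n" for y'
    proof (cases "\<forall>n. \<not> resolvable T M (pre y' n)")
      case nr: True
      then show ?thesis using True n d[OF eq] by (simp add: f_def pre_eq_iff)
    next
      case False
      have "n < N y'"
      proof (rule ccontr)
        assume "\<not> n < N y'"
        then have "resolvable T M (pre y' n)" using False resN resolvable_mono
          by (metis not_less)
        with True eq show False by simp
      qed
      then have "n \<le> N y' - 1" "N y' \<noteq> 0" by auto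
      then have *: "s y' = pre (d y') (g (N y' - 1))" "i < g (N y' - 1)"
        using monoD[OF g(1), of n "N y' - 1"] n by (auto simp: s_def)
      have "f y' i = d y' i"
        using chase_prefix[OF s[OF y'], of "V (pre y' (N y'))" y' "Suc i"] False *
        by (simp add: f_def pre_eq_iff del: chase.simps)
      also have "\<dots> = d y i" using d[OF eq] n by (simp add: pre_eq_iff)
      finally show ?thesis using True by (simp add: f_def)
    qed
    then show ?thesis by blast
  next
    case False
    \<comment> \<open>The first \<open>N y\<close> letters determine \<open>N\<close>,
      \<open>s\<close> and the guess function; the first \<open>Suc i\<close> letters determine the
      chase up to stage \<open>Suc i\<close>.\<close>
    have "f y' i = f y i"
      if y': "y' \<in> words T" and eq: "pre y' (N y + Suc i) = pre y (N y + Suc i)" for y'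
    proof -
      have eqN: "pre y' n = pre y n" if "n \<le> N y" for n
        using pre_eq_mono[OF eq] that by simp
      have r: "resolvable T M (pre y' (N y))" using False resN eqN[of "N y"] by auto
      have NN: "N y' = N y"
        unfolding N_def[of y'] 
      proof (rule Least_equality)
        show "resolvable T M (pre y' (N y))" by (rule r)
        fix n assume "resolvable T M (pre y' n)"
        then show "N y \<le> n" using nresN[of n y] eqN[of n] by (metis not_less less_imp_le)
      qed
      have ss: "s y' = s y"
        using d[OF eqN[of "N y - 1"]] by (simp add: s_def NN)
      have "chase S L (V (pre y (N y))) y' (s y) (Suc i) = chase S L (V (pre y (N y))) y (s y) (Suc i)"
        by (rule chase_cong[OF s[OF y]]) (rule pre_eq_mono[OF eq], simp)
      moreover have "f y' = (\<lambda>i. chase S L (V (pre y' (N y'))) y' (s y') (Suc i) i)"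
        unfolding f_def using r by (intro if_not_P) blast
      moreover have "f y = (\<lambda>i. chase S L (V (pre y (N y))) y (s y) (Suc i) i)"
        unfolding f_def using False by (rule if_not_P)
      ultimately show ?thesis using NN ss eqN[of "N y"] by (simp del: chase.simps)
    qed
    then show ?thesis by blast
  qed
  then have "continuous_map (cantor_top T) (cantor_top S) f"
    using in_words by (intro continuous_map_cantorI)
  moreover have "M = {y \<in> words T. f y \<in> L}" using M red by auto
  ultimately show ?thesis unfolding wadge_le_def by auto
qed


section \<open>Renaming states, and automata given by their counter updates\<close>

text \<open>The simulating automaton is built on an option type; an injection carries its states to
  natural numbers.\<close>

definition rename_trans :: "('p \<Rightarrow> 's) \<Rightarrow> ('p,'a) ctrans set \<Rightarrow> ('s,'a) ctrans set" where
  "rename_trans g Delta = (\<lambda>(p,a,i,p',j). (g p, a, i, g p', j)) ` Delta"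

lemma rename_transI: "(p,a,i,p',j) \<in> Delta \<Longrightarrow> (g p,a,i,g p',j) \<in> rename_trans g Delta"
  by (force simp: rename_trans_def)

lemma rename_transE:
  assumes "(s,a,i,s',j) \<in> rename_trans g Delta"
  obtains p p' where "s = g p" "s' = g p'" "(p,a,i,p',j) \<in> Delta"
  using assms by (auto simp: rename_trans_def)

lemma counter_automatonD:
  assumes "counter_automaton k K Sig Delta q0 F" "(q,a,i,q',j) \<in> Delta"
  shows "q \<in> K" "a \<in> Sig" "q' \<in> K" "length i = k" "length j = k" "set j \<subseteq> {-1,0,1}"
    "m < k \<Longrightarrow> \<not> i ! m \<Longrightarrow> j ! m \<noteq> -1"
  using assms unfolding counter_automaton_def by blast+

lemma counter_automaton_rename:
  assumes "counter_automaton k K Sig Delta q0 F"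
  shows "counter_automaton k (g ` K) Sig (rename_trans g Delta) (g q0) (g ` F)"
  using assms unfolding counter_automaton_def
  by (auto elim!: rename_transE dest: counter_automatonD[OF assms])

lemma blind_counters_rename:
  assumes "blind_counters k Delta"
  shows "blind_counters k (rename_trans g Delta)"
  using assms unfolding blind_counters_def
  by (fastforce elim!: rename_transE intro: rename_transI)

lemma omega_lang_rename:
  assumes aut: "counter_automaton k K Sig Delta q0 F" and g: "inj_on g K"
  shows "omega_lang k Sig (rename_trans g Delta) (g q0) (g ` F) = omega_lang k Sig Delta q0 F"
proof -
  have q0: "q0 \<in> K" and F: "F \<subseteq> K" using aut by (auto simp: counter_automaton_def)
  have fwd: "cstep (rename_trans g Delta) (g (fst C), snd C) a (g (fst C'), snd C')"
    if "cstep Delta C a C'" for C a C'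
    using that unfolding cstep_def by (auto intro: rename_transI)
  have bwd: "fst C' \<in> g ` K \<and>
      cstep Delta (inv_into K g (fst C), snd C) a (inv_into K g (fst C'), snd C')"
    if step: "cstep (rename_trans g Delta) C a C'" for C a C'
  proof -
    obtain i j where ij: "(fst C, a, i, fst C', j) \<in> rename_trans g Delta"
      "length i = length (snd C) \<and> length j = length (snd C) \<and> length (snd C') = length (snd C) \<and>
        (\<forall>m<length (snd C). (i!m \<longleftrightarrow> snd C ! m \<noteq> 0) \<and> int (snd C' ! m) = int (snd C ! m) + j!m)"
      using step unfolding cstep_def by blast
    from ij(1) obtain p p' where p: "fst C = g p" "fst C' = g p'" "(p,a,i,p',j) \<in> Delta"
      by (rule rename_transE)
    moreover have "p \<in> K" "p' \<in> K" using counter_automatonD[OF aut p(3)] by auto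
    ultimately show ?thesis using ij(2) g by (auto simp: cstep_def)
  qed
  have "(\<exists>r. is_run k (rename_trans g Delta) (g q0) x r \<and> (\<exists>\<^sub>\<infinity>n. fst (r n) \<in> g ` F)) \<longleftrightarrow>
        (\<exists>r. is_run k Delta q0 x r \<and> (\<exists>\<^sub>\<infinity>n. fst (r n) \<in> F))" for x
  proof
    assume "\<exists>r. is_run k (rename_trans g Delta) (g q0) x r \<and> (\<exists>\<^sub>\<infinity>n. fst (r n) \<in> g ` F)"
    then obtain r where r: "r 0 = (g q0, replicate k 0)"
      "\<And>n. cstep (rename_trans g Delta) (r n) (x n) (r (Suc n))" "\<exists>\<^sub>\<infinity>n. fst (r n) \<in> g ` F"
      by (auto simp: is_run_def)
    let ?r = "\<lambda>n. (inv_into K g (fst (r n)), snd (r n))"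
    have "is_run k Delta q0 x ?r" using r(1) bwd[OF r(2)] q0 g by (simp add: is_run_def)
    moreover have "\<exists>\<^sub>\<infinity>n. fst (?r n) \<in> F"
      using r(3) by (rule INFM_mono) (use F g in \<open>auto simp: subset_iff\<close>)
    ultimately show "\<exists>r. is_run k Delta q0 x r \<and> (\<exists>\<^sub>\<infinity>n. fst (r n) \<in> F)" by blast
  next
    assume "\<exists>r. is_run k Delta q0 x r \<and> (\<exists>\<^sub>\<infinity>n. fst (r n) \<in> F)"
    then obtain r where r: "r 0 = (q0, replicate k 0)"
      "\<And>n. cstep Delta (r n) (x n) (r (Suc n))" "\<exists>\<^sub>\<infinity>n. fst (r n) \<in> F"
      by (auto simp: is_run_def)
    let ?r = "\<lambda>n. (g (fst (r n)), snd (r n))"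
    have "is_run k (rename_trans g Delta) (g q0) x ?r"
      using r(1) fwd[OF r(2)] by (simp add: is_run_def)
    moreover have "\<exists>\<^sub>\<infinity>n. fst (?r n) \<in> g ` F"
      using r(3) by (rule INFM_mono) auto
    ultimately show "\<exists>r. is_run k (rename_trans g Delta) (g q0) x r \<and> (\<exists>\<^sub>\<infinity>n. fst (r n) \<in> g ` F)"
      by blast
  qed
  then show ?thesis by (simp add: omega_lang_def)
qed

text \<open>\<open>B\<close> prescribes only the updates. Admitting every test vector compatible
  with the update makes the counters blind, and a step is then restricted only by the counters
  staying natural numbers.\<close>

definition blind_trans :: "nat \<Rightarrow> ('p \<Rightarrow> 'a \<Rightarrow> int list \<Rightarrow> 'p \<Rightarrow> bool) \<Rightarrow> ('p,'a) ctrans set" where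
  "blind_trans k B = {(p,a,i,p',j). B p a j p' \<and> length i = k \<and> (\<forall>m<k. \<not> i ! m \<longrightarrow> j ! m \<noteq> -1)}"

lemma blind_counters_blind_trans: "blind_counters k (blind_trans k B)"
  unfolding blind_counters_def blind_trans_def by (auto simp: nth_list_update)

lemma cstep_blind_trans:
  assumes "length (snd C) = k"
  shows "cstep (blind_trans k B) C a C' \<longleftrightarrow>
    (\<exists>j. B (fst C) a j (fst C') \<and> length j = k \<and> length (snd C') = k \<and>
      (\<forall>m<k. int (snd C' ! m) = int (snd C ! m) + j ! m))" (is "?l \<longleftrightarrow> ?r")
proof
  assume ?l then show ?r using assms unfolding cstep_def blind_trans_def by auto
next
  assume ?r
  then obtain j where j: "B (fst C) a j (fst C')" "length j = k" "length (snd C') = k"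
      "\<forall>m<k. int (snd C' ! m) = int (snd C ! m) + j ! m" by blast
  let ?i = "map (\<lambda>n. n \<noteq> 0) (snd C)"
  have "(fst C, a, ?i, fst C', j) \<in> blind_trans k B"
    using j assms unfolding blind_trans_def by auto
  with j assms show ?l unfolding cstep_def by (intro exI[of _ ?i] exI[of _ j]) auto
qed

section \<open>Simulating one counter by four blind counters\<close>

lemma prod_decode_Suc:
  "prod_decode (Suc n) = (case prod_decode n of (k, r) \<Rightarrow> if r = 0 then (0, Suc k) else (Suc k, r - 1))"
proof -
  obtain k r where kr: "prod_decode n = (k, r)" by fastforce
  then have "n = prod_encode (k, r)" by (metis prod_decode_inverse)
  then have "Suc n = prod_encode (if r = 0 then (0, Suc k) else (Suc k, r - 1))"
    by (cases r) (auto simp: prod_encode_def)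
  then show ?thesis using kr by (simp add: prod_encode_inverse split: if_splits)
qed

lemma prod_encode_Suc_right: "prod_encode (0, Suc k) = Suc (prod_encode (k, 0))"
  and prod_encode_Suc_left: "prod_encode (Suc k, r) = Suc (prod_encode (k, Suc r))"
  by (simp_all add: prod_encode_def)

lemma prod_decode_0: "prod_decode 0 = (0, 0)"
  by (simp add: prod_decode_def prod_decode_aux.simps)

text \<open>This is the index of the antidiagonal of the Cantor pairing; block \<open>i\<close> of
  the code is antidiagonal \<open>i\<close>.\<close>

definition block :: "nat \<Rightarrow> nat" where
  "block n = fst (prod_decode n) + snd (prod_decode n)"

lemma block_prod_encode [simp]: "block (prod_encode (k, r)) = k + r"
  by (simp add: block_def)

lemma mono_block: "mono block"
  by (rule incseq_SucI) (auto simp: block_def prod_decode_Suc split: prod.splits)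

text \<open>\<open>prod_encode (i, 0)\<close> is the position of letter \<open>i\<close> in a code,
  so a prefix of length \<open>n\<close> determines the first \<open>block n\<close>
  letters.\<close>

lemma prod_encode_less:
  assumes "i < block n" shows "prod_encode (i, 0) < n"
proof (rule ccontr)
  assume "\<not> ?thesis"
  then have "block n \<le> block (prod_encode (i, 0))" by (intro monoD[OF mono_block]) simp
  with assms show False by simp
qed

text \<open>Blocks are finite and nonempty. This transfers the Buchi condition, as the simulated
  state is constant during a block.\<close>

lemma INFM_block: "(\<exists>\<^sub>\<infinity>n. P (block n)) \<longleftrightarrow> (\<exists>\<^sub>\<infinity>i. P i)"
proof
  assume *: "\<exists>\<^sub>\<infinity>n. P (block n)"
  show "\<exists>\<^sub>\<infinity>i. P i" unfolding INFM_nat_le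
  proof
    fix m
    obtain n where "n \<ge> prod_encode (m, 0)" "P (block n)" using * unfolding INFM_nat_le by blast
    with monoD[OF mono_block this(1)] show "\<exists>i\<ge>m. P i" by auto
  qed
next
  assume *: "\<exists>\<^sub>\<infinity>i. P i"
  show "\<exists>\<^sub>\<infinity>n. P (block n)" unfolding INFM_nat_le
  proof
    fix m
    obtain i where i: "i \<ge> m" "P i" using * unfolding INFM_nat_le by blast
    have "i \<le> prod_encode (i, 0)" by (simp add: prod_encode_def)
    with i show "\<exists>n\<ge>m. P (block n)" by (intro exI[of _ "prod_encode (i, 0)"]) auto
  qed
qed

text \<open>Counters are listed by their role: \<open>a\<close>, \<open>b\<close> is the pair being
  emptied and \<open>c\<close>, \<open>d\<close> the pair being filled; \<open>ro\<close> tells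
  which physical pair has which role.\<close>

definition pk :: "bool \<Rightarrow> 'c \<Rightarrow> 'c \<Rightarrow> 'c \<Rightarrow> 'c \<Rightarrow> 'c list" where
  "pk ro a b c d = (if ro then [c,d,a,b] else [a,b,c,d])"

lemma pk_eq_iff [simp]: "pk ro a b c d = pk ro a' b' c' d' \<longleftrightarrow> a = a' \<and> b = b' \<and> c = c' \<and> d = d'"
  and length_pk [simp]: "length (pk ro a b c d) = 4"
  and set_pk [simp]: "set (pk ro a b c d) = {a,b,c,d}"
  and pk_not: "pk (\<not> ro) a b c d = pk ro c d a b"
  by (auto simp: pk_def)

lemma length4_pk: "length l = 4 \<longleftrightarrow> (\<exists>a b c d. l = pk ro a b c d)"
  by (cases ro) (auto simp: pk_def numeral_eq_Suc length_Suc_conv)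

lemma pk_nth_add:
  "(\<forall>m<4. int (pk ro a' b' c' d' ! m) = int (pk ro a b c d ! m) + pk ro u v w x ! m) \<longleftrightarrow>
    int a' = int a + u \<and> int b' = int b + v \<and> int c' = int c + w \<and> int d' = int d + x"
  by (auto simp: pk_def numeral_eq_Suc All_less_Suc nth_Cons')

lemma cstep_blind_pkE:
  assumes "cstep (blind_trans 4 B) (p, pk ro a b c d) l C'"
  obtains p' a' b' c' d' u v w x where "C' = (p', pk ro a' b' c' d')" "B p l (pk ro u v w x) p'"
    "int a' = int a + u" "int b' = int b + v" "int c' = int c + w" "int d' = int d + x"
proof -
  obtain j where j: "B p l j (fst C')" "length j = 4" "length (snd C') = 4"
      "\<forall>m<4. int (snd C' ! m) = int (pk ro a b c d ! m) + j ! m"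
    using assms by (auto simp: cstep_blind_trans)
  obtain u v w x where pk: "j = pk ro u v w x" using j(2) length4_pk[of j ro] by auto
  obtain a' b' c' d' where "snd C' = pk ro a' b' c' d'" using j(3) length4_pk[of "snd C'" ro] by auto
  then have "C' = (fst C', pk ro a' b' c' d')" by (metis prod.collapse)
  moreover have "int a' = int a + u" "int b' = int b + v" "int c' = int c + w" "int d' = int d + x"
    using j(4) \<open>snd C' = _\<close> pk by (auto simp: pk_nth_add)
  ultimately show thesis using that j(1) pk by blast
qed

lemma cstep_blind_pkI:
  assumes "B p l (pk ro u v w x) p'"
    and "int a' = int a + u" "int b' = int b + v" "int c' = int c + w" "int d' = int d + x"
  shows "cstep (blind_trans 4 B) (p, pk ro a b c d) l (p', pk ro a' b' c' d')"
proof -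
  have "\<forall>m<4. int (pk ro a' b' c' d' ! m) = int (pk ro a b c d ! m) + pk ro u v w x ! m"
    using assms by (simp only: pk_nth_add)
  with assms(1) show ?thesis
    by (subst cstep_blind_trans) (auto intro!: exI[of _ "pk ro u v w x"])
qed

lemma cstep_1:
  assumes "counter_automaton 1 K Sig Delta q0 F"
  shows "cstep Delta (q, [c]) a (q', cs) \<longleftrightarrow>
    (\<exists>j c'. cs = [c'] \<and> (q, a, [c \<noteq> 0], q', [j]) \<in> Delta \<and> int c' = int c + j)" (is "?l \<longleftrightarrow> ?r")
proof
  assume ?l
  then obtain i j where ij: "(q, a, i, q', j) \<in> Delta" "length i = 1" "length j = 1" "length cs = 1"
     "i ! 0 \<longleftrightarrow> c \<noteq> 0" "int (cs ! 0) = int c + j ! 0"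
    by (auto simp: cstep_def)
  then have "i = [c \<noteq> 0]" "j = [j ! 0]" "cs = [cs ! 0]"
    by (auto simp: list_eq_iff_nth_eq)
  with ij show ?r by metis
next
  assume ?r
  then show ?l unfolding cstep_def by fastforce
qed

text \<open>The code of a word is \<open>x\<^sub>0 0 x\<^sub>1 0 0 x\<^sub>2 \<dots>\<close>: block \<open>i\<close> consists of \<open>i\<close> zeros and the letter
  \<open>x\<^sub>i\<close>. With \<open>prod_decode n = (k, r)\<close>, position \<open>n\<close> lies in block \<open>k + r\<close>, after \<open>k\<close> of its zeros
  and with \<open>r\<close> zeros to come.

  When block \<open>i\<close> starts, one pair of counters contains \<open>(c, i - c)\<close>, where \<open>c\<close> is the simulated
  counter, and the other pair is empty. Each zero moves one token to the other pair, and then the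
  pairs exchange their roles (this is what the boolean in the state records). If all \<open>i\<close> tokens
  were moved and none of them came from the first counter, then \<open>c = 0\<close>: this replaces the zero
  test. The flag in the state is 0 if no token was moved from the first counter, 2 if one token of
  the first counter was put on the second one in order to decrement \<open>c\<close>, and 1 otherwise. A block
  with too many zeros blocks the automaton. In a block with too few of them, some token is left when
  the letter is read, so that the automaton may move to the accepting sink \<open>None\<close>.\<close>
locale coded_counter =
  fixes Sig :: "'a set" and K :: "'q set" and Delta :: "('q,'a) ctrans set"
    and q0 :: 'q and F :: "'q set" and e :: "'a \<Rightarrow> nat"
  assumes aut: "counter_automaton 1 K Sig Delta q0 F" and inj_e: "inj_on e Sig"
begin

definition letters :: "nat set" where
  "letters = Suc ` e ` Sig"

definition alphabet :: "nat set" where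
  "alphabet = insert 0 letters"

text \<open>The letter also adds a token, so that the next block is one zero longer. For
  \<open>j = -1\<close> the pair \<open>(c, i - c)\<close> would have to become
  \<open>(c - 1, i - c + 2)\<close>, but a step adds at most 1 to a counter. Hence
  \<open>lower\<close> reroutes one token beforehand, and \<open>letter\<close> checks that this
  guess was right.\<close>

inductive sim :: "('q \<times> nat \<times> bool) option \<Rightarrow> nat \<Rightarrow> int list \<Rightarrow> ('q \<times> nat \<times> bool) option \<Rightarrow> bool" where
  keep: "q \<in> K \<Longrightarrow> (f,f') \<in> {(0,1),(1,1),(2,2)} \<Longrightarrow>
    sim (Some (q,f,ro)) 0 (pk ro (-1) 0 1 0) (Some (q,f',ro))"
| lower: "q \<in> K \<Longrightarrow> sim (Some (q,0,ro)) 0 (pk ro (-1) 0 0 1) (Some (q,2,ro))"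
| keep_co: "q \<in> K \<Longrightarrow> f < 3 \<Longrightarrow> sim (Some (q,f,ro)) 0 (pk ro 0 (-1) 0 1) (Some (q,f,ro))"
| letter: "(q,a,[f \<noteq> 0],q',[j]) \<in> Delta \<Longrightarrow> f < 3 \<Longrightarrow> f = 2 \<longleftrightarrow> j = -1 \<Longrightarrow>
    sim (Some (q,f,ro)) (Suc (e a)) (pk ro 0 0 (if j = 1 then 1 else 0) (if j = 1 then 0 else 1))
      (Some (q',0,\<not> ro))"
| too_short: "q \<in> K \<Longrightarrow> f < 3 \<Longrightarrow> a \<in> Sig \<Longrightarrow> (u,v) \<in> {(-1,0),(0,-1)} \<Longrightarrow>
    sim (Some (q,f,ro)) (Suc (e a)) (pk ro u v 0 0) None"
| sink: "l \<in> alphabet \<Longrightarrow> sim None l (pk False 0 0 0 0) None"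

definition "states = insert None (Some ` (K \<times> {..<3::nat} \<times> (UNIV :: bool set)))"
definition "finals = insert None (Some ` (F \<times> {..<3::nat} \<times> (UNIV :: bool set)))"
definition "init = Some (q0, 0 :: nat, False)"
abbreviation "trans4 \<equiv> blind_trans 4 sim"
definition "coded_lang = omega_lang 4 alphabet trans4 init finals"

lemma finite_alphabet: "finite alphabet"
  using aut by (simp add: alphabet_def letters_def counter_automaton_def)

lemma DeltaD:
  assumes "(q,a,[z],q',[j]) \<in> Delta"
  shows "q \<in> K" "a \<in> Sig" "q' \<in> K" "j \<in> {-1,0,1}" "\<not> z \<Longrightarrow> j \<noteq> -1"
  using counter_automatonD(1-6)[OF aut assms] counter_automatonD(7)[OF aut assms, of 0] by auto

lemma sim_states:
  assumes "sim p l j p'"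
  shows "p \<in> states \<and> l \<in> alphabet \<and> p' \<in> states \<and> length j = 4 \<and> set j \<subseteq> {-1,0,1}"
  using assms
proof cases
  case (letter q a f q' j ro)
  then show ?thesis using DeltaD[OF letter(5)] by (auto simp: states_def alphabet_def letters_def)
qed (auto simp: states_def alphabet_def letters_def)

lemma counter_automaton_trans4: "counter_automaton 4 states alphabet trans4 init finals"
proof -
  have "finite K" "q0 \<in> K" "F \<subseteq> K" using aut by (auto simp: counter_automaton_def)
  then have "finite states" "init \<in> states" "finals \<subseteq> states"
    by (auto simp: states_def init_def finals_def)
  with finite_alphabet sim_states show ?thesis
    unfolding counter_automaton_def blind_trans_def by fast
qed

text \<open>\<open>u\<close> and \<open>v\<close> count the tokens that are left in the old pair of counters, \<open>a\<close> and \<open>b\<close> those that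
  were taken from its first and its second counter.\<close>
definition in_block :: "'q \<Rightarrow> nat \<Rightarrow> bool \<Rightarrow> nat \<Rightarrow> nat \<Rightarrow> nat \<Rightarrow>
    ('q \<times> nat \<times> bool) option \<times> nat list \<Rightarrow> bool" where
  "in_block q c ro f k r C \<longleftrightarrow> (\<exists>u v a b. c = u + a \<and> k = a + b \<and> r = u + v \<and> q \<in> K \<and> f < 3 \<and>
     (f = 0 \<longleftrightarrow> a = 0) \<and> C = (Some (q,f,ro),
       pk ro u v (if f = 2 then a - 1 else a) (if f = 2 then b + 1 else b)))"

section \<open>Simulation within one block\<close>

lemma in_block_init: "in_block q0 0 False 0 0 0 (init, replicate 4 0)"
  using aut by (auto simp: in_block_def init_def pk_def counter_automaton_def numeral_eq_Suc)

lemma in_blockI: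
  assumes "C = (Some (q,f,ro), pk ro u v (if f = 2 then a - 1 else a) (if f = 2 then b + 1 else b))"
    and "q \<in> K" "f < 3" "f = 0 \<longleftrightarrow> a = 0" "c = u + a" "k = a + b" "r = u + v"
  shows "in_block q c ro f k r C"
  using assms unfolding in_block_def by blast

lemma in_blockE:
  assumes "in_block q c ro f k r C"
  obtains u v a b where
    "C = (Some (q,f,ro), pk ro u v (if f = 2 then a - 1 else a) (if f = 2 then b + 1 else b))"
    "q \<in> K" "f < 3" "f = 0 \<longleftrightarrow> a = 0" "c = u + a" "k = a + b" "r = u + v"
  using assms unfolding in_block_def by blast

text \<open>Each zero consumes one of the \<open>r\<close> tokens left in the old pair, so no run
  survives a zero too many.\<close>

lemma in_block_zero:
  assumes "in_block q c ro f k r C" "cstep trans4 C 0 C'"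
  shows "\<exists>r' f'. r = Suc r' \<and> in_block q c ro f' (Suc k) r' C'"
proof -
  from assms(1) obtain u v a b where
    C: "C = (Some (q,f,ro), pk ro u v (if f = 2 then a - 1 else a) (if f = 2 then b + 1 else b))"
    "q \<in> K" "f < 3" "f = 0 \<longleftrightarrow> a = 0" "c = u + a" "k = a + b" "r = u + v"
    by (rule in_blockE)
  from assms(2)[unfolded C(1)] obtain p' u' v' a' b' ju jv ja jb where
    C': "C' = (p', pk ro u' v' a' b')" "sim (Some (q,f,ro)) 0 (pk ro ju jv ja jb) p'"
    "int u' = int u + ju" "int v' = int v + jv"
    "int a' = int (if f = 2 then a - 1 else a) + ja" "int b' = int (if f = 2 then b + 1 else b) + jb"
    by (rule cstep_blind_pkE)
  from C'(2) show ?thesis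
  proof cases
    case (keep f')
    have "in_block q c ro f' (Suc k) (u' + v) C'"
      using keep C C' by (intro in_blockI[of _ _ _ _ u' v "Suc a" b]) auto
    moreover have "r = Suc (u' + v)" using keep C C' by auto
    ultimately show ?thesis by blast
  next
    case lower
    have "in_block q c ro 2 (Suc k) (u' + v) C'"
      using lower C C' by (intro in_blockI[of _ _ _ _ u' v "Suc a" b]) auto
    moreover have "r = Suc (u' + v)" using lower C C' by auto
    ultimately show ?thesis by blast
  next
    case keep_co
    have "in_block q c ro f (Suc k) (u + v') C'"
      using keep_co C C' by (intro in_blockI[of _ _ _ _ u v' a "Suc b"]) auto
    moreover have "r = Suc (u + v')" using keep_co C C' by auto
    ultimately show ?thesis by blast
  qed
qed

text \<open>\<open>dec\<close> tells whether the coming letter decrements, as known from the run to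
  be simulated. The first counter is emptied first, and its first token fixes the flag
  accordingly.\<close>

lemma in_block_zero_ex:
  assumes "in_block q c ro f k (Suc r) C" "f \<noteq> 0 \<Longrightarrow> f = 2 \<longleftrightarrow> dec"
  shows "\<exists>C' f'. cstep trans4 C 0 C' \<and> in_block q c ro f' (Suc k) r C' \<and> (f' \<noteq> 0 \<longrightarrow> (f' = 2 \<longleftrightarrow> dec))"
proof -
  from assms(1) obtain u v a b where
    C: "C = (Some (q,f,ro), pk ro u v (if f = 2 then a - 1 else a) (if f = 2 then b + 1 else b))"
    "q \<in> K" "f < 3" "f = 0 \<longleftrightarrow> a = 0" "c = u + a" "k = a + b" "Suc r = u + v"
    by (rule in_blockE)
  show ?thesis
  proof (cases u)
    case 0
    define C' where "C' = (Some (q,f,ro), pk ro u (v - 1) (if f = 2 then a - 1 else a)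
        (if f = 2 then Suc b + 1 else Suc b))"
    have "cstep trans4 C 0 C'"
      unfolding C(1) C'_def
      by (rule cstep_blind_pkI[where B = sim, OF sim.keep_co]) (use C 0 in \<open>auto simp: of_nat_diff\<close>)
    moreover have "in_block q c ro f (Suc k) r C'"
      unfolding C'_def by (rule in_blockI[of _ _ _ _ u "v - 1" a "Suc b"]) (use C 0 in auto)
    ultimately show ?thesis using assms(2) by blast
  next
    case (Suc u')
    define f' :: nat where "f' = (if dec then 2 else 1)"
    define C' where "C' = (Some (q,f',ro), pk ro u' v (if f' = 2 then Suc a - 1 else Suc a)
        (if f' = 2 then b + 1 else b))"
    have f: "f = 0 \<or> f = f'" using assms(2) C by (auto simp: f'_def)
    have "cstep trans4 C 0 C'"
    proof (cases "f = 0 \<and> dec")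
      case True
      then show ?thesis
        unfolding C(1) C'_def f'_def using C Suc
        by (auto intro!: cstep_blind_pkI[where B = sim, OF sim.lower])
    next
      case False
      then have "(f, f') \<in> {(0,1),(1,1),(2,2)}" using f by (auto simp: f'_def)
      then show ?thesis
        unfolding C(1) C'_def using C Suc
        by (intro cstep_blind_pkI[where B = sim, OF sim.keep]) auto
    qed
    moreover have "in_block q c ro f' (Suc k) r C'"
      unfolding C'_def by (rule in_blockI[of _ _ _ _ u' v "Suc a" b]) (use C Suc in \<open>auto simp: f'_def\<close>)
    moreover have "f' \<noteq> 0 \<longrightarrow> (f' = 2 \<longleftrightarrow> dec)" by (simp add: f'_def)
    ultimately show ?thesis by blast
  qed
qed

text \<open>With the old pair empty, all \<open>c\<close> tokens of its first counter were moved, so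
  flag 0 means \<open>c = 0\<close> and replaces the zero test. For the same reason
  \<open>too_short\<close> cannot fire.\<close>

lemma in_block_letter:
  assumes "in_block q c ro f k 0 C" "a \<in> Sig" "cstep trans4 C (Suc (e a)) C'"
  shows "\<exists>q' c' j. (q,a,[c \<noteq> 0],q',[j]) \<in> Delta \<and> int c' = int c + j \<and>
    in_block q' c' (\<not> ro) 0 0 (Suc k) C'"
proof -
  from assms(1) obtain b where
    C: "C = (Some (q,f,ro), pk ro 0 0 (if f = 2 then c - 1 else c) (if f = 2 then b + 1 else b))"
    "q \<in> K" "f < 3" "f = 0 \<longleftrightarrow> c = 0" "k = c + b"
    by (auto elim: in_blockE)
  from assms(3)[unfolded C(1)] obtain p' u' v' c' b' ju jv jc jb where
    C': "C' = (p', pk ro u' v' c' b')" "sim (Some (q,f,ro)) (Suc (e a)) (pk ro ju jv jc jb) p'"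
    "int u' = int 0 + ju" "int v' = int 0 + jv"
    "int c' = int (if f = 2 then c - 1 else c) + jc" "int b' = int (if f = 2 then b + 1 else b) + jb"
    by (rule cstep_blind_pkE)
  from C'(2) show ?thesis
  proof cases
    case (letter a' q' j)
    note D = DeltaD[OF letter(4)]
    have a': "a' = a" using inj_e assms(2) D letter by (auto simp: inj_on_def)
    have "(q,a,[c \<noteq> 0],q',[j]) \<in> Delta" using letter C a' by simp
    moreover have "int c' = int c + j" using letter C C' D by (auto split: if_splits)
    moreover have "in_block q' c' (\<not> ro) 0 0 (Suc k) C'"
      using letter C C' D
      by (intro in_blockI[of _ _ _ _ c' b' 0 0]) (auto simp: pk_not split: if_splits)
    ultimately show ?thesis by blast
  next
    case too_short
    with C' show ?thesis by auto
  qed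
qed

lemma in_block_letter_ex:
  assumes "in_block q c ro f k 0 C" "f \<noteq> 0 \<Longrightarrow> f = 2 \<longleftrightarrow> j = -1"
    "(q,a,[c \<noteq> 0],q',[j]) \<in> Delta" "int c' = int c + j"
  shows "\<exists>C'. cstep trans4 C (Suc (e a)) C' \<and> in_block q' c' (\<not> ro) 0 0 (Suc k) C'"
proof -
  from assms(1) obtain b where
    C: "C = (Some (q,f,ro), pk ro 0 0 (if f = 2 then c - 1 else c) (if f = 2 then b + 1 else b))"
    "q \<in> K" "f < 3" "f = 0 \<longleftrightarrow> c = 0" "k = c + b"
    by (auto elim: in_blockE)
  note D = DeltaD[OF assms(3)]
  \<comment> \<open>If the flag is 0, then \<open>c = 0\<close>, and the automaton has no decrement
    on a zero counter.\<close>
  have f: "f = 2 \<longleftrightarrow> j = -1" using assms(2) C D by auto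
  define b' where "b' = (if f = 2 then b + 1 else b) + (if j = 1 then 0 else 1)"
  define C' where "C' = (Some (q', 0::nat, \<not> ro), pk ro 0 0 c' b')"
  have "sim (Some (q,f,ro)) (Suc (e a)) (pk ro 0 0 (if j = 1 then 1 else 0) (if j = 1 then 0 else 1))
      (Some (q',0,\<not> ro))"
    using assms C f by (intro sim.letter) auto
  then have "cstep trans4 C (Suc (e a)) C'"
    unfolding C(1) C'_def
    by (rule cstep_blind_pkI) (use assms C D f in \<open>auto simp: b'_def of_nat_diff\<close>)
  moreover have "in_block q' c' (\<not> ro) 0 0 (Suc k) C'"
    unfolding C'_def using assms C D f
    by (intro in_blockI[of _ _ _ _ c' b' 0 0]) (auto simp: pk_not b'_def)
  ultimately show ?thesis by blast
qed

lemma in_block_too_short: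
  assumes "in_block q c ro f k (Suc r) C" "a \<in> Sig"
  shows "\<exists>cs. length cs = 4 \<and> cstep trans4 C (Suc (e a)) (None, cs)"
proof -
  obtain u v x y where C: "Suc r = u + v" "q \<in> K" "f < 3" "C = (Some (q,f,ro), pk ro u v x y)"
    using assms(1) by (auto elim: in_blockE)
  show ?thesis
  proof (cases u)
    case 0
    have "cstep trans4 C (Suc (e a)) (None, pk ro u (v - 1) x y)"
      unfolding C(4)
      by (rule cstep_blind_pkI[where B = sim, OF sim.too_short[of q f a 0 "-1"]])
        (use C 0 assms(2) in \<open>auto simp: of_nat_diff\<close>)
    then show ?thesis by (intro exI conjI) (rule length_pk)
  next
    case (Suc u')
    have "cstep trans4 C (Suc (e a)) (None, pk ro u' v x y)"
      unfolding C(4)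
      by (rule cstep_blind_pkI[where B = sim, OF sim.too_short[of q f a "-1" 0]]) (use C Suc assms(2) in auto)
    then show ?thesis by (intro exI conjI) (rule length_pk)
  qed
qed

lemma cstep_sink:
  assumes "length cs = 4" "l \<in> alphabet"
  shows "cstep trans4 (None, cs) l (None, cs)"
proof -
  obtain a b c d where cs: "cs = pk False a b c d" using assms(1) length4_pk[of cs False] by auto
  show ?thesis unfolding cs by (rule cstep_blind_pkI[where B = sim, OF sim.sink[OF assms(2)]]) auto
qed

section \<open>Codes of words and runs on them\<close>

abbreviation "lang \<equiv> omega_lang 1 Sig Delta q0 F"

text \<open>\<open>Suc\<close> keeps the letters apart from the padding symbol 0.\<close>

definition encode :: "(nat \<Rightarrow> 'a) \<Rightarrow> nat \<Rightarrow> nat" where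
  "encode x n = (if snd (prod_decode n) = 0 then Suc (e (x (fst (prod_decode n)))) else 0)"

text \<open>Only the positions of letters are read, so every word has a decoding, even one that is
  not a code.\<close>

definition decode :: "(nat \<Rightarrow> nat) \<Rightarrow> nat \<Rightarrow> 'a" where
  "decode y k = inv_into Sig e (y (prod_encode (k, 0)) - 1)"

definition fits :: "nat \<Rightarrow> nat \<Rightarrow> bool" where
  "fits n l \<longleftrightarrow> (if snd (prod_decode n) = 0 then l \<in> letters else l = 0)"

lemma lettersE:
  assumes "l \<in> letters" obtains a where "a \<in> Sig" "l = Suc (e a)"
  using assms by (auto simp: letters_def)

lemma encode_words: "x \<in> words Sig \<Longrightarrow> encode x \<in> words alphabet"
  by (auto simp: words_def encode_def alphabet_def letters_def)

lemma decode_words: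
  assumes "\<And>n. fits n (y n)"
  shows "decode y \<in> words Sig"
proof (rule wordsI)
  fix k
  have "y (prod_encode (k, 0)) \<in> letters" using assms[of "prod_encode (k, 0)"] by (simp add: fits_def)
  then show "decode y k \<in> Sig" using inj_e by (auto elim!: lettersE simp: decode_def)
qed

lemma encode_decode:
  assumes "\<And>n. fits n (y n)"
  shows "encode (decode y) = y"
proof
  fix n
  obtain k r where kr: "prod_decode n = (k, r)" by fastforce
  then have n: "n = prod_encode (k, r)" by (metis prod_decode_inverse)
  show "encode (decode y) n = y n"
  proof (cases "r = 0")
    case True
    then have "y n \<in> letters" using assms[of n] kr by (simp add: fits_def)
    then show ?thesis using inj_e True kr n by (auto elim!: lettersE simp: encode_def decode_def)
  next
    case False
    then show ?thesis using assms[of n] kr by (simp add: fits_def encode_def)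
  qed
qed

lemma decode_cong:
  assumes "pre y n = pre y' n"
  shows "pre (decode y) (block n) = pre (decode y') (block n)"
  using assms prod_encode_less[of _ n] by (auto simp: pre_eq_iff decode_def)

text \<open>While the word fits, a letter is read only when the old pair is empty, so the accepting
  sink cannot be entered.\<close>

lemma partial_run_in_block:
  assumes "R 0 = (init, replicate 4 0)"
    and "\<And>m. m < n \<Longrightarrow> cstep trans4 (R m) (y m) (R (Suc m))"
    and "\<And>m. m < n \<Longrightarrow> fits m (y m)"
  shows "\<exists>q c ro f. in_block q c ro f (fst (prod_decode n)) (snd (prod_decode n)) (R n)"
  using assms(2,3)
proof (induction n)
  case 0
  then show ?case using in_block_init assms(1) by (auto simp: prod_decode_0)
next
  case (Suc n)
  obtain k r where kr: "prod_decode n = (k, r)" by fastforce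
  obtain q c ro f where in_block: "in_block q c ro f k r (R n)"
    using Suc kr by auto
  have step: "cstep trans4 (R n) (y n) (R (Suc n))" and fits: "fits n (y n)" using Suc.prems by auto
  show ?case
  proof (cases "r = 0")
    case True
    then obtain a where "a \<in> Sig" "y n = Suc (e a)"
      using fits kr by (auto simp: fits_def elim: lettersE)
    with in_block_letter[of q c ro f k "R n" a "R (Suc n)"] step in_block True
    show ?thesis by (auto simp: prod_decode_Suc kr)
  next
    case False
    then have "y n = 0" using fits kr by (simp add: fits_def)
    with in_block_zero[OF in_block, of "R (Suc n)"] step obtain r' f'
      where "r = Suc r'" "in_block q c ro f' (Suc k) r' (R (Suc n))" by auto
    then have "in_block q c ro f' (fst (prod_decode (Suc n))) (snd (prod_decode (Suc n))) (R (Suc n))"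
      by (simp add: prod_decode_Suc kr)
    then show ?thesis by blast
  qed
qed

text \<open>At its first wrong position a word can only be accepted by a run that is still alive there,
  and any such run may move to the accepting sink if the letter came too early.\<close>
lemma coded_lang_misfit:
  assumes y: "y \<in> coded_lang" and y': "y' \<in> words alphabet" "pre y' (Suc n) = pre y (Suc n)"
    and fits: "\<And>m. m < n \<Longrightarrow> fits m (y m)" "\<not> fits n (y n)"
  shows "y' \<in> coded_lang"
proof -
  obtain R where R: "R 0 = (init, replicate 4 0)" "\<And>m. cstep trans4 (R m) (y m) (R (Suc m))"
    using y by (auto simp: coded_lang_def omega_lang_def is_run_def)
  have "y n \<in> alphabet" using y by (auto simp: coded_lang_def omega_lang_def)
  obtain k r where kr: "prod_decode n = (k, r)" by fastforce
  obtain q c ro f where in_block: "in_block q c ro f k r (R n)"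
    using partial_run_in_block[of R n y] R fits(1) kr by auto
  \<comment> \<open>A surplus zero would have blocked the run, so the misplaced symbol is a letter
    with zeros still to come.\<close>
  have "y n \<noteq> 0"
  proof
    assume "y n = 0"
    then have "r = 0" using fits(2) kr by (auto simp: fits_def split: if_splits)
    with in_block_zero[OF in_block, of "R (Suc n)"] R(2)[of n] \<open>y n = 0\<close> show False by auto
  qed
  then have "y n \<in> letters" using \<open>y n \<in> alphabet\<close> by (simp add: alphabet_def)
  then obtain a where a: "a \<in> Sig" "y n = Suc (e a)" by (rule lettersE)
  obtain r' where "r = Suc r'"
    using fits(2) kr \<open>y n \<in> letters\<close> by (cases r) (auto simp: fits_def)
  then obtain cs where cs: "length cs = 4" "cstep trans4 (R n) (y n) (None, cs)"
    using in_block_too_short[of q c ro f k r' "R n" a] in_block a by auto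
  define R' where "R' m = (if m \<le> n then R m else (None, cs))" for m
  have "cstep trans4 (R' m) (y' m) (R' (Suc m))" for m
  proof -
    consider "m < n" | "m = n" | "m > n" by linarith
    then show ?thesis
    proof cases
      case 1
      then have "y' m = y m" using y'(2) by (simp add: pre_eq_iff)
      with 1 R(2)[of m] show ?thesis by (simp add: R'_def)
    next
      case 2
      then have "y' m = y m" using y'(2) by (simp add: pre_eq_iff)
      with 2 cs(2) show ?thesis by (simp add: R'_def)
    next
      case 3
      with cstep_sink[OF cs(1) wordsD[OF y'(1)]] show ?thesis by (simp add: R'_def)
    qed
  qed
  then have "is_run 4 trans4 init y' R'" using R(1) by (simp add: is_run_def R'_def)
  moreover have "\<exists>\<^sub>\<infinity>m. fst (R' m) \<in> finals"
    unfolding INFM_nat_le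
  proof
    fix m
    have "fst (R' (max m (Suc n))) \<in> finals" by (simp add: R'_def finals_def)
    then show "\<exists>k\<ge>m. fst (R' k) \<in> finals" using max.cobounded1 by blast
  qed
  ultimately show ?thesis using y'(1) by (auto simp: coded_lang_def omega_lang_def words_def)
qed

lemma in_block_advance:
  assumes "in_block q c ro f 0 i (R (prod_encode (0, i)))"
    and R: "\<And>n. cstep trans4 (R n) (encode x n) (R (Suc n))"
    and "k + r = i"
  shows "\<exists>f. in_block q c ro f k r (R (prod_encode (k, r)))"
  using assms(3)
proof (induction k arbitrary: r)
  case 0
  then show ?case using assms(1) by auto
next
  case (Suc k)
  then obtain f where f: "in_block q c ro f k (Suc r) (R (prod_encode (k, Suc r)))" by force
  have "cstep trans4 (R (prod_encode (k, Suc r))) 0 (R (prod_encode (Suc k, r)))"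
    using R[of "prod_encode (k, Suc r)"] by (simp add: encode_def prod_encode_Suc_left)
  from in_block_zero[OF f this] show ?case by auto
qed

lemma encode_in_coded_lang_imp:
  assumes x: "x \<in> words Sig" and acc: "encode x \<in> coded_lang"
  shows "x \<in> lang"
proof -
  obtain R where R: "R 0 = (init, replicate 4 0)"
      "\<And>n. cstep trans4 (R n) (encode x n) (R (Suc n))" "\<exists>\<^sub>\<infinity>n. fst (R n) \<in> finals"
    using acc by (auto simp: coded_lang_def omega_lang_def is_run_def)
  \<comment> \<open>The simulated run is read off at the starts of blocks, where the first old
    counter contains exactly \<open>c\<close>. The clause for \<open>i = 0\<close> ties the choice
    to the initial configuration.\<close>
  define P where "P i s = (case s of (q,c,ro) \<Rightarrow>
      in_block q c ro 0 0 i (R (prod_encode (0,i))) \<and> (i = 0 \<longrightarrow> q = q0 \<and> c = 0))" for i s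
  define Q where "Q i s s' = (case (s, s') of ((q,c,_::bool), (q',c',_::bool)) \<Rightarrow>
      cstep Delta (q,[c]) (x i) (q',[c']))" for i s s'
  have "\<exists>s. \<forall>i. P i (s i) \<and> Q i (s i) (s (Suc i))"
  proof (rule dependent_nat_choice)
    show "\<exists>s. P 0 s"
      using in_block_init R(1) by (auto simp: P_def prod_encode_def)
  next
    fix s i assume "P i s"
    then obtain q c ro where s: "s = (q,c,ro)" "in_block q c ro 0 0 i (R (prod_encode (0,i)))"
      by (auto simp: P_def split: prod.splits)
    obtain f where f: "in_block q c ro f i 0 (R (prod_encode (i,0)))"
      using in_block_advance[OF s(2) R(2), of i 0] by auto
    have "cstep trans4 (R (prod_encode (i,0))) (Suc (e (x i))) (R (prod_encode (0, Suc i)))"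
      using R(2)[of "prod_encode (i,0)"] by (simp add: encode_def prod_encode_Suc_right)
    from in_block_letter[OF f wordsD[OF x] this] obtain q' c' j where
      *: "(q,x i,[c \<noteq> 0],q',[j]) \<in> Delta" "int c' = int c + j"
        "in_block q' c' (\<not> ro) 0 0 (Suc i) (R (prod_encode (0, Suc i)))" by blast
    then have "cstep Delta (q,[c]) (x i) (q',[c'])" by (auto simp: cstep_1[OF aut])
    with * show "\<exists>s'. P (Suc i) s' \<and> Q i s s'"
      by (intro exI[of _ "(q', c', \<not> ro)"]) (auto simp: P_def Q_def s(1))
  qed
  then obtain s where s: "\<And>i. P i (s i)" "\<And>i. Q i (s i) (s (Suc i))" by blast
  let ?r = "\<lambda>i. (fst (s i), [fst (snd (s i))])"
  have "cstep Delta (?r i) (x i) (?r (Suc i))" for i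
    using s(2)[of i] by (simp add: Q_def split_beta)
  moreover have "?r 0 = (q0, [0])" using s(1)[of 0] by (simp add: P_def split_beta)
  ultimately have "is_run 1 Delta q0 x ?r" by (simp add: is_run_def)
  \<comment> \<open>On a code the run stays out of the sink, and the simulated state does not change
    during a block.\<close>
  moreover have "fst (s (block n)) \<in> F" if fin: "fst (R n) \<in> finals" for n
  proof -
    obtain k r where kr: "prod_decode n = (k, r)" by fastforce
    then have n: "n = prod_encode (k, r)" by (metis prod_decode_inverse)
    obtain q c ro where q: "s (block n) = (q,c,ro)" using prod_cases3 by blast
    then have "in_block q c ro 0 0 (k + r) (R (prod_encode (0, k + r)))"
      using s(1)[of "block n"] by (simp add: P_def n)
    from in_block_advance[OF this R(2) refl] obtain f where "in_block q c ro f k r (R n)"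
      using n by blast
    then show ?thesis using fin q by (auto simp: finals_def elim!: in_blockE)
  qed
  then have "\<exists>\<^sub>\<infinity>n. fst (s (block n)) \<in> F" by (rule INFM_mono[OF R(3)])
  then have "\<exists>\<^sub>\<infinity>i. fst (?r i) \<in> F" unfolding INFM_block[of "\<lambda>i. fst (s i) \<in> F"] by simp
  ultimately show ?thesis using x unfolding omega_lang_def words_def by blast
qed

lemma encode_in_coded_lang:
  assumes "x \<in> lang"
  shows "encode x \<in> coded_lang"
proof -
  have x: "x \<in> words Sig" using assms by (auto simp: omega_lang_def words_def)
  obtain r where r: "r 0 = (q0, [0])" "\<And>i. cstep Delta (r i) (x i) (r (Suc i))" "\<exists>\<^sub>\<infinity>i. fst (r i) \<in> F"
    using assms by (auto simp: omega_lang_def is_run_def)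
  define q where "q i = fst (r i)" for i
  define c where "c i = hd (snd (r i))" for i
  have rqc: "r i = (q i, [c i])" for i
  proof (induction i)
    case 0
    then show ?case by (simp add: q_def c_def r(1))
  next
    case (Suc i)
    have "cstep Delta (q i, [c i]) (x i) (q (Suc i), snd (r (Suc i)))"
      using r(2)[of i] unfolding Suc by (simp add: q_def)
    then have "snd (r (Suc i)) = [c (Suc i)]" by (auto simp: cstep_1[OF aut] c_def)
    then show ?case by (metis prod.collapse q_def)
  qed
  have "\<exists>j. (q i, x i, [c i \<noteq> 0], q (Suc i), [j]) \<in> Delta \<and> int (c (Suc i)) = int (c i) + j" for i
    using r(2)[of i] by (auto simp: rqc cstep_1[OF aut])
  then obtain j where j: "\<And>i. (q i, x i, [c i \<noteq> 0], q (Suc i), [j i]) \<in> Delta"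
      "\<And>i. int (c (Suc i)) = int (c i) + j i" by metis
  \<comment> \<open>A nonzero flag has to announce correctly whether the letter of the current block
    decrements; \<open>in_block_letter_ex\<close> relies on this at the end of the block.\<close>
  define P where "P n C = (\<exists>ro f.
      in_block (q (block n)) (c (block n)) ro f (fst (prod_decode n)) (snd (prod_decode n)) C \<and>
      (f \<noteq> 0 \<longrightarrow> (f = 2 \<longleftrightarrow> j (block n) = -1)) \<and> (n = 0 \<longrightarrow> C = (init, replicate 4 0)))" for n C
  have "\<exists>R. \<forall>n. P n (R n) \<and> cstep trans4 (R n) (encode x n) (R (Suc n))"
  proof (rule dependent_nat_choice)
    have "q 0 = q0" "c 0 = 0" by (auto simp: q_def c_def r(1))
    then show "\<exists>C. P 0 C" using in_block_init by (auto simp: P_def prod_decode_0 block_def)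
  next
    fix C n assume P: "P n C"
    obtain k t where kt: "prod_decode n = (k, t)" by fastforce
    obtain ro f where f: "in_block (q (k + t)) (c (k + t)) ro f k t C"
        "f \<noteq> 0 \<Longrightarrow> f = 2 \<longleftrightarrow> j (k + t) = -1"
      using P by (auto simp: P_def kt block_def)
    show "\<exists>C'. P (Suc n) C' \<and> cstep trans4 C (encode x n) C'"
    proof (cases t)
      case 0
      with in_block_letter_ex[OF _ _ j(1)[of k] j(2)[of k], of ro f k C] f show ?thesis
        by (auto simp: P_def block_def prod_decode_Suc kt encode_def)
    next
      case (Suc t')
      with in_block_zero_ex[of "q (k + t)" "c (k + t)" ro f k t' C "j (k + t) = -1"] f
      obtain C' f' where "cstep trans4 C 0 C'" "in_block (q (k + t)) (c (k + t)) ro f' (Suc k) t' C'"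
        "f' \<noteq> 0 \<longrightarrow> (f' = 2 \<longleftrightarrow> j (k + t) = -1)" by auto
      then show ?thesis using Suc
        by (intro exI[of _ C']) (auto simp: P_def block_def prod_decode_Suc kt encode_def)
    qed
  qed
  then obtain R where R: "\<And>n. P n (R n)" "\<And>n. cstep trans4 (R n) (encode x n) (R (Suc n))" by blast
  have "is_run 4 trans4 init (encode x) R"
    using R(1)[of 0] R(2) by (auto simp: is_run_def P_def)
  moreover have "\<exists>\<^sub>\<infinity>n. q (block n) \<in> F"
    using r(3) unfolding INFM_block[of "\<lambda>i. q i \<in> F"] by (simp add: q_def)
  then have "\<exists>\<^sub>\<infinity>n. fst (R n) \<in> finals"
  proof (rule INFM_mono)
    fix n assume "q (block n) \<in> F"
    with R(1)[of n] show "fst (R n) \<in> finals" by (auto simp: P_def finals_def elim!: in_blockE)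
  qed
  ultimately show ?thesis
    using encode_words[OF x] by (auto simp: coded_lang_def omega_lang_def words_def)
qed

section \<open>The two Wadge reductions\<close>

lemma lang_words: "lang \<subseteq> words Sig"
  and coded_lang_words: "coded_lang \<subseteq> words alphabet"
  by (auto simp: coded_lang_def omega_lang_def words_def)

lemma encode_iff: "x \<in> words Sig \<Longrightarrow> encode x \<in> coded_lang \<longleftrightarrow> x \<in> lang"
  using encode_in_coded_lang encode_in_coded_lang_imp by blast

lemma wadge_le_coded_lang: "wadge_le (cantor_top Sig) lang (cantor_top alphabet) coded_lang"
  unfolding wadge_le_def
proof (intro exI conjI)
  show "continuous_map (cantor_top Sig) (cantor_top alphabet) encode"
  proof (rule continuous_map_cantorI)
    fix x i assume "x \<in> words Sig"
    show "\<exists>n. \<forall>y\<in>words Sig. pre y n = pre x n \<longrightarrow> encode y i = encode x i"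
      by (intro exI[of _ "Suc (fst (prod_decode i))"]) (auto simp: encode_def pre_eq_iff)
  qed (rule encode_words)
  show "lang = {x \<in> topspace (cantor_top Sig). encode x \<in> coded_lang}"
    using lang_words encode_iff by auto
qed

lemma filterlim_block: "filterlim block sequentially sequentially"
  unfolding filterlim_at_top eventually_sequentially
proof
  fix m
  have "m \<le> block n" if "prod_encode (0, m) \<le> n" for n
    using monoD[OF mono_block that] by simp
  then show "\<exists>N. \<forall>n\<ge>N. m \<le> block n" by blast
qed

text \<open>For words that are not codes, the prefix ending with the first misfit decides membership
  by \<open>coded_lang_misfit\<close>. So guesses are required only for codes, and there they are
  pulled back along \<open>decode\<close>.\<close>

lemma resolvable_coded_lang:
  assumes v: "\<And>z. z \<in> words alphabet \<Longrightarrow> pre z n = pre y n \<Longrightarrow> (\<And>m. fits m (z m)) \<Longrightarrow>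
    \<forall>\<^sub>F m in sequentially. v (pre (decode z) m) = (decode z \<in> lang)"
  shows "resolvable alphabet coded_lang (pre y n)"
proof -
  \<comment> \<open>After a misfit the guess asks whether any accepted word begins with
    \<open>u\<close>. Before it, \<open>v\<close> sees just the \<open>block (length u)\<close>
    letters that \<open>u\<close> determines; by \<open>decode_cong\<close> the values of
    \<open>u ! i\<close> beyond the end of \<open>u\<close> do not enter.\<close>
  define v' where "v' u = (if \<exists>m<length u. \<not> fits m (u ! m) then \<exists>z\<in>coded_lang. pre z (length u) = u
      else v (pre (decode (\<lambda>i. u ! i)) (block (length u))))" for u
  have "\<forall>\<^sub>F m in sequentially. v' (pre z m) = (z \<in> coded_lang)"
    if z: "z \<in> words alphabet" "pre z n = pre y n" for z
  proof (cases "\<forall>m. fits m (z m)")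
    case True
    have "v' (pre z m) = v (pre (decode z) (block m))" for m
    proof -
      have "pre (\<lambda>i. pre z m ! i) m = pre z m" by (simp add: pre_eq_iff)
      from decode_cong[OF this] have "v' (pre z m) =
          (if \<exists>k<m. \<not> fits k (pre z m ! k) then \<exists>w\<in>coded_lang. pre w m = pre z m
           else v (pre (decode z) (block m)))"
        by (simp only: v'_def length_pre)
      moreover have "\<not> (\<exists>k<m. \<not> fits k (pre z m ! k))" using True by auto
      ultimately show ?thesis by simp
    qed
    moreover have "\<forall>\<^sub>F m in sequentially. v (pre (decode z) (block m)) = (decode z \<in> lang)"
      using eventually_compose_filterlim[OF v[OF z] filterlim_block] True by blast
    moreover have "decode z \<in> lang \<longleftrightarrow> z \<in> coded_lang"
      using encode_iff[of "decode z"] decode_words[of z] encode_decode[of z] True by simp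
    ultimately show ?thesis by simp
  next
    case False
    then obtain m0 where m0: "\<not> fits m0 (z m0)" "\<And>m. m < m0 \<Longrightarrow> fits m (z m)"
      using exists_least_iff[of "\<lambda>m. \<not> fits m (z m)"] by auto
    have "v' (pre z m) = (z \<in> coded_lang)" if "m \<ge> Suc m0" for m
    proof -
      have "v' (pre z m) \<longleftrightarrow> (\<exists>w\<in>coded_lang. pre w m = pre z m)"
        using m0(1) that by (auto simp: v'_def)
      also have "\<dots> \<longleftrightarrow> z \<in> coded_lang"
      proof
        assume "\<exists>w\<in>coded_lang. pre w m = pre z m"
        then obtain w where w: "w \<in> coded_lang" "pre w m = pre z m" by blast
        then have eq: "pre z (Suc m0) = pre w (Suc m0)" using pre_eq_mono that by metis
        then have "w i = z i" if "i \<le> m0" for i using that by (simp add: pre_eq_iff)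
        with coded_lang_misfit[OF w(1) z(1) eq] m0 show "z \<in> coded_lang" by simp
      qed blast
      finally show ?thesis .
    qed
    then show ?thesis unfolding eventually_sequentially by blast
  qed
  then show ?thesis unfolding resolvable_def length_pre by blast
qed

text \<open>The player decodes the opponent's word. Guesses for \<open>lang\<close> pull back to
  guesses for \<open>coded_lang\<close>, so a nonresolvable prefix has a nonresolvable decoding; and
  a misfit makes the prefix resolvable, so a word that never becomes resolvable is a code.\<close>

lemma wadge_coded_lang_le:
  assumes "\<not> resolvable Sig lang []"
  shows "wadge_le (cantor_top alphabet) coded_lang (cantor_top Sig) lang"
proof (rule wadge_le_by_decoding[OF assms coded_lang_words decode_cong mono_block])
  show "\<exists>n. i < block n" for i
    by (rule exI[of _ "prod_encode (0, Suc i)"]) simp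
next
  fix y n
  assume *: "\<not> resolvable alphabet coded_lang (pre y n)"
  show "\<not> resolvable Sig lang (pre (decode y) (block n))"
  proof
    assume "resolvable Sig lang (pre (decode y) (block n))"
    then obtain v where v: "\<And>x. x \<in> words Sig \<Longrightarrow> pre x (block n) = pre (decode y) (block n) \<Longrightarrow>
        \<forall>\<^sub>F m in sequentially. v (pre x m) = (x \<in> lang)"
      unfolding resolvable_def length_pre by blast
    have "resolvable alphabet coded_lang (pre y n)"
    proof (rule resolvable_coded_lang)
      fix z assume "pre z n = pre y n" "\<And>m. fits m (z m)"
      then show "\<forall>\<^sub>F m in sequentially. v (pre (decode z) m) = (decode z \<in> lang)"
        by (intro v decode_words decode_cong)
    qed
    with * show False by simp
  qed
next
  fix y assume *: "\<forall>n. \<not> resolvable alphabet coded_lang (pre y n)"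
  have fits: "fits m (y m)" for m
  proof (rule ccontr)
    assume m: "\<not> fits m (y m)"
    \<comment> \<open>No extension of this prefix is a code, so the condition on the guess is
      vacuous and an arbitrary \<open>v\<close> serves.\<close>
    have "resolvable alphabet coded_lang (pre y (Suc m))"
    proof (rule resolvable_coded_lang)
      fix z assume "pre z (Suc m) = pre y (Suc m)" "\<And>m. fits m (z m)"
      then have "fits m (y m)" by (metis lessI pre_eq_iff)
      with m show "\<forall>\<^sub>F m in sequentially. undefined (pre (decode z) m) = (decode z \<in> lang)" by simp
    qed
    with * show False by blast
  qed
  show "y \<in> coded_lang \<longleftrightarrow> decode y \<in> lang"
    using encode_iff[OF decode_words[OF fits]] encode_decode[OF fits] by simp
qed

end

theorem mainTheorem2:
  fixes Sig :: "'a set" and K :: "'q set" and Delta :: "('q,'a) ctrans set"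
    and q0 :: 'q and F :: "'q set" and L :: "(nat \<Rightarrow> 'a) set"
  assumes "finite Sig"
    and "counter_automaton 1 K Sig Delta q0 F"
    and "L = omega_lang 1 Sig Delta q0 F"
    and "analytic_in (cantor_top Sig) L"
    and "\<not> borel_in (cantor_top Sig) L"
  shows "\<exists>(Gam :: nat set) (K' :: nat set) Delta' q0' F'.
           finite Gam \<and> counter_automaton 4 K' Gam Delta' q0' F' \<and> blind_counters 4 Delta' \<and>
           wadge_equiv (cantor_top Sig) L (cantor_top Gam) (omega_lang 4 Gam Delta' q0' F')"
proof -
  obtain e :: "'a \<Rightarrow> nat" where "inj_on e Sig"
    using finite_imp_inj_to_nat_seg[OF assms(1)] by blast
  then interpret coded_counter Sig K Delta q0 F e
    using assms(2) by unfold_locales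
  have "finite states" using counter_automaton_trans4 by (simp add: counter_automaton_def)
  then obtain g :: "('q \<times> nat \<times> bool) option \<Rightarrow> nat" where g: "inj_on g states"
    using finite_imp_inj_to_nat_seg by blast
  have "\<not> resolvable Sig lang []"
    using resolvable_Nil_imp_borel[OF _ lang_words] assms(3,5) by blast
  then have "wadge_equiv (cantor_top Sig) L (cantor_top alphabet) coded_lang"
    using wadge_le_coded_lang wadge_coded_lang_le assms(3) by (simp add: wadge_equiv_def)
  moreover have "omega_lang 4 alphabet (rename_trans g trans4) (g init) (g ` finals) = coded_lang"
    unfolding coded_lang_def by (rule omega_lang_rename[OF counter_automaton_trans4 g])
  ultimately show ?thesis
    using finite_alphabet counter_automaton_rename[OF counter_automaton_trans4, of g]
      blind_counters_rename[OF blind_counters_blind_trans[of 4 sim], of g]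
    by (intro exI[of _ alphabet] exI[of _ "g ` states"] exI[of _ "rename_trans g trans4"]
        exI[of _ "g init"] exI[of _ "g ` finals"]) simp
qed

end
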